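(* For every positive integer $h$, the average distance of the multiplicative circulant graph $\Gamma_{3^h}=MC(3^h)$ is $$\mu(\Gamma_{3^h})=\frac{2h\cdot 3^{h-1}}{3^h-1}.$$
   Context: For integers $m>1$, $h>0$, $MC(m^h)$ is the graph with vertex set $\mathbb{Z}_{m^h}$ in which distinct vertices $x,y$ are adjacent iff $x-y\equiv \pm m^i \pmod{m^h}$ for some $i\in\{0,\ldots,h-1\}$. For a graph $\Gamma$ with $N$ vertices, the average distance is $\mu(\Gamma)=\frac{1}{N(N-1)}\sum_{v_i,v_j\in V(\Gamma)} d_\Gamma(v_i,v_j)$, the sum over all ordered pairs of vertices, where $d_\Gamma$ is shortest-path distance. *)

theory Defs
  imports "Graph_Theory.Graph_Theory" "HOL-Number_Theory.Cong"
begin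

text \<open>
  Undirected graphs are symmetric loop-free digraphs (locale \<^locale>\<open>pair_graph\<close>),
  and the vertices of $MC(m^h)$ are the least nonnegative representatives of the
  residues modulo $m^h$.
\<close>

definition MC :: "nat \<Rightarrow> nat \<Rightarrow> int pair_pre_digraph" where
  "MC m h = \<lparr> pverts = {0..<int m ^ h},
     parcs = {(x, y). x \<in> {0..<int m ^ h} \<and> y \<in> {0..<int m ^ h} \<and> x \<noteq> y \<and>
       (\<exists>i<h. [x - y = int m ^ i] (mod int m ^ h) \<or> [x - y = - (int m ^ i)] (mod int m ^ h))} \<rparr>"

lemma pair_graph_MC: "pair_graph (MC m h)"
proof
  show "finite (pverts (MC m h))"
    by (simp add: MC_def)
  show "finite (parcs (MC m h))"
    by (rule finite_subset[of _ "{0..<int m ^ h} \<times> {0..<int m ^ h}"]) (auto simp: MC_def)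
  have "[y - x = a] (mod n) \<longleftrightarrow> [x - y = - a] (mod n)" for x y a n :: int
    using cong_minus_minus_iff[of "y - x" a n] by simp
  then show "symmetric (with_proj (MC m h))"
    by (auto simp: symmetric_def sym_def MC_def arcs_ends_def arc_to_ends_def)
qed (auto simp: MC_def)

text \<open>
  Shortest-path distance is the infimum of the walk costs for the unit arc weight.  It takes
  the value \<^term>\<open>\<infinity> :: ereal\<close> between vertices not joined by a walk, so the sum is formed
  in the extended reals.
\<close>

definition distance :: "('a, 'b) pre_digraph \<Rightarrow> 'a \<Rightarrow> 'a \<Rightarrow> ereal" where
  "distance G u v = wf_digraph.\<mu> G (\<lambda>_. 1) u v"

definition average_distance :: "('a, 'b) pre_digraph \<Rightarrow> ereal" where
  "average_distance G =
     (\<Sum>u\<in>verts G. \<Sum>v\<in>verts G. distance G u v)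
       / ereal (real (card (verts G)) * (real (card (verts G)) - 1))"

end

theory Submission
  imports Defs
begin

text \<open>
  The distance from \<open>u\<close> to \<open>v\<close> in $MC(3^h)$ is the number of nonzero digits among the
  \<open>h\<close> lowest balanced ternary digits of \<open>v - u\<close>: adding $\pm 3^i$ changes this weight by at
  most one (a carry turns the digit $\pm 1$ into $\mp 1$ and hence costs nothing at its own
  position), and cancelling a nonzero digit lowers it by one.  Each of the \<open>h\<close> digits is
  nonzero for two thirds of the residues, so the distances from a fixed vertex sum to
  $2h\,3^{h-1}$.
\<close>

section \<open>Balanced ternary weight of integers\<close>

fun balanced_weight :: "nat \<Rightarrow> int \<Rightarrow> nat" where
  "balanced_weight 0 x = 0"
| "balanced_weight (Suc h) x = (if 3 dvd x then 0 else 1) + balanced_weight h ((x + 1) div 3)"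

text \<open>\<open>(x + 1) div 3\<close> rounds \<open>x / 3\<close> to the nearest integer, so the
  remainder is a digit in -1, 0, 1. This form with an explicit digit drives the inductions
  below.\<close>

lemma balanced_weight_digit:
  assumes "\<bar>d\<bar> \<le> 1"
  shows "balanced_weight (Suc h) (3 * y + d) = nat \<bar>d\<bar> + balanced_weight h y"
proof -
  have "d = -1 \<or> d = 0 \<or> d = 1" using assms by linarith
  moreover have "(3 * y - 1 + 1) div 3 = y" "(3 * y + 1) div 3 = y" "(3 * y + 1 + 1) div 3 = y"
    by presburger+
  moreover have "\<not> 3 dvd 3 * y - 1" "\<not> 3 dvd 3 * y + 1" by presburger+
  ultimately show ?thesis by auto
qed

lemma balanced_digit_cases:
  fixes x :: int
  obtains y d where "x = 3 * y + d" "\<bar>d\<bar> \<le> 1"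
proof (rule that[of "(x + 1) div 3" "x - 3 * ((x + 1) div 3)"])
  show "\<bar>x - 3 * ((x + 1) div 3)\<bar> \<le> 1" by presburger
qed simp

lemma balanced_weight_zero: "balanced_weight h 0 = 0"
  by (induction h) simp_all

text \<open>A multiple of \<open>3 ^ h\<close> leaves the \<open>h\<close> lowest digits alone, so
  the weight is well defined on residues.\<close>

lemma balanced_weight_periodic: "balanced_weight h (x + k * 3 ^ h) = balanced_weight h x"
proof (induction h arbitrary: x)
  case (Suc h)
  obtain y d where x: "x = 3 * y + d" and d: "\<bar>d\<bar> \<le> 1" by (rule balanced_digit_cases)
  have "x + k * 3 ^ Suc h = 3 * (y + k * 3 ^ h) + d" by (simp add: x)
  then show ?case using balanced_weight_digit[OF d] Suc.IH x by metis
qed simp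

lemma balanced_weight_cong:
  assumes "[x = y] (mod 3 ^ h)"
  shows "balanced_weight h x = balanced_weight h y"
proof -
  obtain k where "y = x + k * 3 ^ h"
    using assms by (metis cong_iff_lin mult.commute)
  then show ?thesis by (simp add: balanced_weight_periodic)
qed

text \<open>The position \<open>i\<close> ranges over all naturals so that the induction also covers
  a carry out of the top digit.\<close>

lemma balanced_weight_step:
  assumes "s = 1 \<or> s = -1"
  shows "balanced_weight h (x + s * 3 ^ i) \<le> Suc (balanced_weight h x)"
proof (induction h arbitrary: x i)
  case (Suc h)
  obtain y d where x: "x = 3 * y + d" and d: "\<bar>d\<bar> \<le> 1" by (rule balanced_digit_cases)
  note wx = balanced_weight_digit[OF d, of h y, folded x]
  show ?case
  proof (cases i)
    case (Suc j)
    then have "x + s * 3 ^ i = 3 * (y + s * 3 ^ j) + d" by (simp add: x)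
    then have "balanced_weight (Suc h) (x + s * 3 ^ i)
        = nat \<bar>d\<bar> + balanced_weight h (y + s * 3 ^ j)"
      using balanced_weight_digit[OF d] by metis
    then show ?thesis using Suc.IH[of y j] wx by linarith
  next
    case 0
    show ?thesis
    proof (cases "\<bar>d + s\<bar> \<le> 1")
      case True
      have "x + s * 3 ^ i = 3 * y + (d + s)" by (simp add: x 0)
      then have "balanced_weight (Suc h) (x + s * 3 ^ i) = nat \<bar>d + s\<bar> + balanced_weight h y"
        using balanced_weight_digit[OF True] by metis
      then show ?thesis using True wx by linarith
    next
      case False
      \<comment> \<open>The carry case: \<open>d + s = 3 * s - s\<close>, so the digit becomes
        \<open>- s\<close>, equally heavy, and only the carry \<open>s\<close> into the next
        position can raise the weight.\<close>
      then have ds: "d = s" using assms d by linarith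
      have s: "\<bar>- s\<bar> \<le> 1" using assms by auto
      have "x + s * 3 ^ i = 3 * (y + s) + (- s)" by (simp add: x 0 ds)
      then have "balanced_weight (Suc h) (x + s * 3 ^ i)
          = nat \<bar>- s\<bar> + balanced_weight h (y + s)"
        using balanced_weight_digit[OF s] by metis
      moreover have "balanced_weight h (y + s) \<le> Suc (balanced_weight h y)"
        using Suc.IH[of y 0] by simp
      ultimately show ?thesis using wx ds by simp
    qed
  qed
qed simp

lemma balanced_weight_eq_0_imp_dvd: "balanced_weight h x = 0 \<Longrightarrow> 3 ^ h dvd x"
proof (induction h arbitrary: x)
  case (Suc h)
  obtain y d where x: "x = 3 * y + d" and d: "\<bar>d\<bar> \<le> 1" by (rule balanced_digit_cases)
  from Suc.prems have "nat \<bar>d\<bar> = 0" "balanced_weight h y = 0"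
    using balanced_weight_digit[OF d, of h y] x by auto
  then show ?case using Suc.IH x by simp
qed simp

text \<open>The step cancels the lowest nonzero digit: zero digits are passed over, raising
  \<open>i\<close>, and the first nonzero \<open>d\<close> is met with
  \<open>s = - d\<close>.\<close>

lemma balanced_weight_descent:
  assumes "balanced_weight h x = Suc n"
  obtains i s where "i < h" "s = 1 \<or> s = -1" "balanced_weight h (x + s * 3 ^ i) = n"
proof -
  have "\<exists>i s. i < h \<and> (s = 1 \<or> s = -1) \<and> balanced_weight h (x + s * 3 ^ i) = n"
    using assms
  proof (induction h arbitrary: x n)
    case (Suc h)
    obtain y d where x: "x = 3 * y + d" and d: "\<bar>d\<bar> \<le> 1" by (rule balanced_digit_cases)
    note wx = balanced_weight_digit[OF d, of h y, folded x]
    show ?case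
    proof (cases "d = 0")
      case True
      then obtain i s where i: "i < h" and s: "s = 1 \<or> s = -1"
        and n: "balanced_weight h (y + s * 3 ^ i) = n"
        using Suc.IH[of y n] Suc.prems wx by auto
      have "x + s * 3 ^ Suc i = 3 * (y + s * 3 ^ i) + 0" by (simp add: x True)
      then have "balanced_weight (Suc h) (x + s * 3 ^ Suc i) = n"
        using balanced_weight_digit[of 0] n by (metis abs_zero add_0 nat_0 zero_le_one)
      then show ?thesis using i s Suc_less_eq by blast
    next
      case False
      then have s: "- d = 1 \<or> - d = -1" using d by linarith
      have "x + (- d) * 3 ^ 0 = 3 * y + 0" by (simp add: x)
      then have "balanced_weight (Suc h) (x + (- d) * 3 ^ 0) = balanced_weight h y"
        using balanced_weight_digit[of 0] by (metis abs_zero add_0 nat_0 zero_le_one)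
      moreover have "balanced_weight h y = n" using Suc.prems wx s by auto
      ultimately show ?thesis using s zero_less_Suc by blast
    qed
  qed simp
  then show ?thesis using that by blast
qed

section \<open>Summing the weight over all residues\<close>

text \<open>Translation by \<open>a\<close> permutes the residues modulo \<open>n\<close>.\<close>

lemma sum_periodic_shift:
  fixes f :: "int \<Rightarrow> 'a::comm_monoid_add"
  assumes "\<And>x y. [x = y] (mod n) \<Longrightarrow> f x = f y" and "n > 0"
  shows "(\<Sum>x\<in>{0..<n}. f (x + a)) = (\<Sum>x\<in>{0..<n}. f x)"
proof (rule sum.reindex_bij_witness[where i = "\<lambda>y. (y - a) mod n" and j = "\<lambda>x. (x + a) mod n"])
  show "f ((x + a) mod n) = f (x + a)" for x
    by (rule assms(1)) (simp add: cong_def)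
qed (use assms(2) in \<open>simp_all add: mod_simps\<close>)

lemma sum_triple_interval:
  fixes f :: "int \<Rightarrow> 'a::comm_monoid_add"
  assumes "n \<ge> 0"
  shows "(\<Sum>x\<in>{0..<3 * n}. f x) = (\<Sum>y\<in>{0..<n}. f (3 * y) + f (3 * y + 1) + f (3 * y + 2))"
  using assms
proof (induction n rule: int_ge_induct)
  case (step n)
  have "{0..<3 * (n + 1)} = {0..<3 * n} \<union> {3 * n, 3 * n + 1, 3 * n + 2}"
    and "{0..<n + 1} = insert n {0..<n}"
    using step.hyps by auto
  then show ?case using step by (simp add: sum.union_disjoint add_ac)
qed simp

lemma sum_balanced_weight:
  "(\<Sum>x\<in>{0..<3 ^ h}. balanced_weight h x) = 2 * h * 3 ^ (h - 1)"
proof (induction h)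
  case (Suc h)
  let ?w = "balanced_weight h"
  \<comment> \<open>The residue 2 is the digit -1 with a carry, as
    \<open>3 * y + 2 = 3 * (y + 1) - 1\<close>; \<open>shift\<close> then removes the carry from the
    sum.\<close>
  have digits: "balanced_weight (Suc h) (3 * y) = ?w y"
    "balanced_weight (Suc h) (3 * y + 1) = Suc (?w y)"
    "balanced_weight (Suc h) (3 * y + 2) = Suc (?w (y + 1))" for y
    using balanced_weight_digit[of 0 h y] balanced_weight_digit[of 1 h y]
      balanced_weight_digit[of "-1" h "y + 1"] by (simp_all add: algebra_simps del: balanced_weight.simps)
  have shift: "(\<Sum>y\<in>{0..<3 ^ h}. ?w (y + 1)) = (\<Sum>y\<in>{0..<3 ^ h}. ?w y)"
    by (rule sum_periodic_shift) (auto intro: balanced_weight_cong)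
  have "(\<Sum>x\<in>{0..<3 ^ Suc h}. balanced_weight (Suc h) x)
      = (\<Sum>y\<in>{0..<3 ^ h}. ?w y + Suc (?w y) + Suc (?w (y + 1)))"
    using sum_triple_interval[of "3 ^ h" "balanced_weight (Suc h)"]
    by (simp add: digits del: balanced_weight.simps)
  also have "\<dots> = 3 * (\<Sum>y\<in>{0..<3 ^ h}. ?w y) + 2 * 3 ^ h"
    using shift by (simp add: sum.distrib sum_Suc nat_power_eq)
  also have "\<dots> = 2 * Suc h * 3 ^ (Suc h - 1)"
    \<comment> \<open>For \<open>h = 0\<close> the exponent \<open>h - 1\<close> is truncated, but
      the factor \<open>h\<close> makes the term vanish.\<close>
    using Suc.IH by (cases h) simp_all
  finally show ?case .
qed simp

section \<open>Distances in MC(3^h)\<close>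

context
  fixes h :: nat
begin

interpretation pair_graph "MC 3 h" by (rule pair_graph_MC)

text \<open>Each arc lowers the weight of the remaining difference by at most one, and at
  \<open>v\<close> that weight is zero.\<close>

lemma awalk_length_ge_balanced_weight:
  assumes "awalk u p v"
  shows "balanced_weight h (v - u) \<le> length p"
  using assms
proof (induction p arbitrary: u)
  case Nil
  then show ?case by (simp add: awalk_Nil_iff balanced_weight_zero)
next
  case (Cons e p)
  obtain u' where e: "e = (u, u')" "(u, u') \<in> parcs (MC 3 h)" and p: "awalk u' p v"
    using Cons.prems by (cases e) (auto simp: awalk_Cons_iff)
  then obtain i where "[u - u' = 3 ^ i] (mod 3 ^ h) \<or> [u - u' = - (3 ^ i)] (mod 3 ^ h)"
    by (auto simp: MC_def)
  \<comment> \<open>The sign is chosen so that \<open>v - u\<close> is congruent to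
    \<open>(v - u') + s * 3 ^ i\<close>.\<close>
  then obtain s :: int where s: "s = 1 \<or> s = -1" and "[u - u' = - (s * 3 ^ i)] (mod 3 ^ h)"
    by (metis minus_minus mult_1 mult_minus_left)
  then have "[(v - u') - (u - u') = (v - u') - (- (s * 3 ^ i))] (mod 3 ^ h)"
    by (intro cong_diff cong_refl)
  then have "balanced_weight h (v - u) = balanced_weight h ((v - u') + s * 3 ^ i)"
    by (intro balanced_weight_cong) simp
  also have "\<dots> \<le> Suc (balanced_weight h (v - u'))"
    by (rule balanced_weight_step[OF s])
  finally show ?case using Cons.IH[OF p] by simp
qed

text \<open>Greedy walk: every arc cancels one nonzero digit of the difference still to be
  covered.\<close>

lemma exists_awalk_of_balanced_weight:
  assumes "u \<in> {0..<3 ^ h}" "v \<in> {0..<3 ^ h}"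
  shows "\<exists>p. awalk u p v \<and> length p = balanced_weight h (v - u)"
  using assms
proof (induction "balanced_weight h (v - u)" arbitrary: u)
  case 0
  then have "3 ^ h dvd v - u" using balanced_weight_eq_0_imp_dvd by simp
  then have "v mod 3 ^ h = u mod 3 ^ h" by (simp add: mod_eq_dvd_iff)
  then have "u = v" using 0 by simp
  moreover have "u \<in> verts (with_proj (MC 3 h))" using 0 by (simp add: MC_def)
  ultimately have "awalk u [] v" by (simp add: awalk_Nil_iff)
  then show ?case using 0 by (intro exI[of _ "[]"]) simp
next
  case (Suc n)
  then obtain i s where i: "i < h" and s: "s = 1 \<or> s = -1"
    and n: "balanced_weight h (v - u + s * 3 ^ i) = n"
    using balanced_weight_descent by metis
  \<comment> \<open>Subtracting from \<open>u\<close> adds \<open>s * 3 ^ i\<close> to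
    \<open>v - u\<close>; the reduction keeps \<open>u'\<close> in the vertex set.\<close>
  define u' where "u' = (u - s * 3 ^ i) mod 3 ^ h"
  have "[u - u' = u - (u - s * 3 ^ i)] (mod 3 ^ h)"
    unfolding u'_def by (intro cong_diff) (simp_all add: cong_def)
  then have arc: "[u - u' = s * 3 ^ i] (mod 3 ^ h)" by simp
  have "[v - u' = v - (u - s * 3 ^ i)] (mod 3 ^ h)"
    unfolding u'_def by (intro cong_diff) (simp_all add: cong_def)
  then have n': "n = balanced_weight h (v - u')"
    using n balanced_weight_cong by (metis diff_diff_eq2 diff_add_eq)
  have u': "u' \<in> {0..<3 ^ h}" by (simp add: u'_def)
  then obtain p where p: "awalk u' p v" "length p = n"
    using Suc.hyps(1)[OF n' _ Suc.prems(2)] n' by auto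
  \<comment> \<open>The weights of \<open>v - u\<close> and \<open>v - u'\<close> differ by one, so
    the arc is not a loop.\<close>
  have "u \<noteq> u'" using Suc.hyps(2) n' by auto
  then have "(u, u') \<in> parcs (MC 3 h)"
    using arc s i u' Suc.prems by (auto simp: MC_def)
  then have "awalk u ((u, u') # p) v" using p by (simp add: awalk_Cons_iff)
  then show ?case using p Suc.hyps(2) by (intro exI[of _ "(u, u') # p"]) simp
qed

lemma distance_MC_3:
  assumes "u \<in> {0..<3 ^ h}" "v \<in> {0..<3 ^ h}"
  shows "distance (with_proj (MC 3 h)) u v = ereal (real (balanced_weight h (v - u)))"
proof -
  have cost: "awalk_cost (\<lambda>_. 1) p = real (length p)" for p :: "(int \<times> int) list"
    by (induction p) simp_all
  obtain p where p: "awalk u p v" "length p = balanced_weight h (v - u)"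
    using exists_awalk_of_balanced_weight[OF assms] by blast
  have "\<mu> (\<lambda>_. 1) u v \<le> ereal (real (balanced_weight h (v - u)))"
    using min_cost_le_walk_cost[OF p(1), of "\<lambda>_. 1"] by (simp add: cost p(2))
  moreover have "ereal (real (balanced_weight h (v - u))) \<le> \<mu> (\<lambda>_. 1) u v"
    unfolding \<mu>_def by (rule INF_greatest) (simp add: cost awalk_length_ge_balanced_weight)
  ultimately show ?thesis unfolding distance_def by (rule antisym)
qed

end

theorem theorem3p27:
  fixes h :: nat
  assumes "h > 0"
  shows "average_distance (with_proj (MC 3 h)) = ereal (2 * real h * 3 ^ (h - 1) / (3 ^ h - 1))"
proof -
  let ?V = "{0..<3 ^ h :: int}"
  have verts: "verts (with_proj (MC 3 h)) = ?V" by (simp add: MC_def)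
  have card: "real (card ?V) = 3 ^ h" by (simp add: nat_power_eq)
  have "(\<Sum>v\<in>?V. distance (with_proj (MC 3 h)) u v) = ereal (2 * real h * 3 ^ (h - 1))"
    if "u \<in> ?V" for u
  proof -
    \<comment> \<open>Translation by \<open>- u\<close> shows that all vertices have the same
      distance sum as vertex 0.\<close>
    have "(\<Sum>v\<in>?V. balanced_weight h (v + - u)) = (\<Sum>v\<in>?V. balanced_weight h v)"
      by (rule sum_periodic_shift) (auto intro: balanced_weight_cong)
    then have "(\<Sum>v\<in>?V. balanced_weight h (v - u)) = 2 * h * 3 ^ (h - 1)"
      by (simp add: sum_balanced_weight)
    then have "(\<Sum>v\<in>?V. real (balanced_weight h (v - u))) = 2 * real h * 3 ^ (h - 1)"
      by (simp flip: of_nat_sum)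
    then show ?thesis using that by (simp add: distance_MC_3)
  qed
  then have "(\<Sum>u\<in>?V. \<Sum>v\<in>?V. distance (with_proj (MC 3 h)) u v)
      = (\<Sum>u\<in>?V. ereal (2 * real h * 3 ^ (h - 1)))"
    by (rule sum.cong[OF refl])
  also have "\<dots> = ereal (3 ^ h * (2 * real h * 3 ^ (h - 1)))"
    by (simp only: sum_ereal sum_constant card)
  finally have total: "(\<Sum>u\<in>?V. \<Sum>v\<in>?V. distance (with_proj (MC 3 h)) u v)
      = ereal (3 ^ h * (2 * real h * 3 ^ (h - 1)))" .
  \<comment> \<open>Here \<open>h > 0\<close> enters: the denominator is nonzero, so the extended
    real quotient is a real one and \<open>3 ^ h\<close> cancels.\<close>
  have "(3 :: real) ^ h - 1 \<noteq> 0" using one_less_power[of "3 :: real" h] assms by linarith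
  then show ?thesis
    unfolding average_distance_def verts total card by simp
qed

end
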